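(* Let $g>0$, $f_M>0$, and consider a point particle moving under constant gravity $-g\vec e_z$ inside the ideally reflecting paraboloid $z=\frac{x^2+y^2}{4f_M}-f_M$, whose focus is the origin $O$. For every trajectory of this billiard (with its conserved values of the energy height $H$ and of the reduced angular momentum $l_z$), there is a number $R\ge 0$ such that the foci $\vec F_i$ of all consecutive flight parabolas of the trajectory satisfy $|\vec F_i|=R$; that is, all these foci lie on a common sphere of radius $R$ centered at the origin $O$.
   Context: The mirror is the zero set of $M(x,y,z)=z-\frac{x^2+y^2}{4f_M}+f_M$ in $\mathbb{R}^3$, and the particle moves in the region $M\ge 0$. Between reflections the particle moves freely under gravity: $\vec r(t)=-\tfrac12 g t^2\vec e_z+\vec v t+\vec r_0$; each such arc (extended to all $t\in\mathbb{R}$) is called a flight parabola. When the particle hits the mirror at a point $P$ with velocity $\vec v$, its velocity is replaced by $$\vec v'=\vec v-\frac{2}{|\vec\nabla M(P)|^2}\,(\vec v\cdot\vec\nabla M(P))\,\vec\nabla M(P),\qquad \vec\nabla M=\left(-\tfrac{x}{2f_M},-\tfrac{y}{2f_M},1\right)^T,$$ and it continues on the next flight parabola, starting at $P$ with velocity $\vec v'$. A trajectory is a (finite or infinite) sequence of consecutive flights obtained this way. Energy height: $H=\frac{|\vec v|^2}{2g}+z$, constant along a trajectory. Reduced angular momentum: $l_z=x v_y-y v_x$, also constant along a trajectory. A flight parabola has focal length $F=\frac{v_x^2+v_y^2}{2g}$ (the horizontal velocity being constant along the flight), and its focus is $\vec F=\vec S-F\vec e_z$, where $\vec S$ is its vertex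 (highest point). Equivalently, for a flight parabola passing through the point $(x_0,y_0,z_0)$ with velocity $(v_x,v_y,v_z)$ there, $$\vec F=\begin{pmatrix}x_0\\ y_0\\ 2z_0-H\end{pmatrix}+\frac{v_z}{g}\begin{pmatrix}v_x\\ v_y\\ v_z\end{pmatrix}.$$ *)

theory Defs
  imports "HOL-Analysis.Analysis" "HOL-Library.Extended_Nat"
begin

definition e_z :: "real ^ 3" where
  "e_z = vector [0, 0, 1]"

definition mirror :: "real \<Rightarrow> real ^ 3 \<Rightarrow> real" where
  "mirror f p = p $ 3 - ((p $ 1)\<^sup>2 + (p $ 2)\<^sup>2) / (4 * f) + f"

definition mirror_grad :: "real \<Rightarrow> real ^ 3 \<Rightarrow> real ^ 3" where
  "mirror_grad f p = vector [- (p $ 1) / (2 * f), - (p $ 2) / (2 * f), 1]"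

definition reflect :: "real \<Rightarrow> real ^ 3 \<Rightarrow> real ^ 3 \<Rightarrow> real ^ 3" where
  "reflect f p v = v - (2 / (norm (mirror_grad f p))\<^sup>2 * (v \<bullet> mirror_grad f p)) *\<^sub>R mirror_grad f p"

definition flight :: "real \<Rightarrow> real ^ 3 \<Rightarrow> real ^ 3 \<Rightarrow> real \<Rightarrow> real ^ 3" where
  "flight g p v t = - (g * t\<^sup>2 / 2) *\<^sub>R e_z + t *\<^sub>R v + p"

definition flight_velocity :: "real \<Rightarrow> real ^ 3 \<Rightarrow> real \<Rightarrow> real ^ 3" where
  "flight_velocity g v t = v - (g * t) *\<^sub>R e_z"

lemma flight_has_vector_derivative:
  "(flight g p v has_vector_derivative flight_velocity g v t) (at t)"
  unfolding flight_def flight_velocity_def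
  by (auto intro!: derivative_eq_intros simp: algebra_simps)

definition vertex :: "real \<Rightarrow> real ^ 3 \<Rightarrow> real ^ 3 \<Rightarrow> real ^ 3" where
  "vertex g p v = (THE s. s \<in> range (flight g p v) \<and> (\<forall>q \<in> range (flight g p v). q $ 3 \<le> s $ 3))"

definition focal_length :: "real \<Rightarrow> real ^ 3 \<Rightarrow> real" where
  "focal_length g v = ((v $ 1)\<^sup>2 + (v $ 2)\<^sup>2) / (2 * g)"

definition flight_focus :: "real \<Rightarrow> real ^ 3 \<Rightarrow> real ^ 3 \<Rightarrow> real ^ 3" where
  "flight_focus g p v = vertex g p v - focal_length g v *\<^sub>R e_z"

definition energy_height :: "real \<Rightarrow> real ^ 3 \<Rightarrow> real ^ 3 \<Rightarrow> real" where
  "energy_height g p v = (norm v)\<^sup>2 / (2 * g) + p $ 3"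

definition angular_momentum_z :: "real ^ 3 \<Rightarrow> real ^ 3 \<Rightarrow> real" where
  "angular_momentum_z p v = p $ 1 * v $ 2 - p $ 2 * v $ 1"

text \<open>
  A trajectory consists of \<open>N\<close> flights, where \<open>N = \<infinity>\<close> is allowed. Flight \<open>i\<close> starts at \<open>p i\<close> with
  velocity \<open>v i\<close> (its own clock starting at 0) and is followed for the time \<open>T i\<close>, at the end of
  which the particle is reflected if there is a next flight. The last flight of a finite
  trajectory need not end on the mirror. Since \<open>mirror f\<close> is strictly concave along a flight (for
  positive \<open>g\<close> and \<open>f\<close>), it is positive strictly between the ends of a flight, so a reflection
  takes place at the first hit.
\<close>

definition billiard_trajectory ::
  "real \<Rightarrow> real \<Rightarrow> enat \<Rightarrow> (nat \<Rightarrow> real ^ 3) \<Rightarrow> (nat \<Rightarrow> real ^ 3) \<Rightarrow> (nat \<Rightarrow> real) \<Rightarrow> bool" where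
  "billiard_trajectory g f N p v T \<longleftrightarrow>
     0 < N \<and>
     (\<forall>i. enat i < N \<longrightarrow> 0 < T i \<and> (\<forall>t \<in> {0..T i}. 0 \<le> mirror f (flight g (p i) (v i) t))) \<and>
     (\<forall>i. enat (Suc i) < N \<longrightarrow>
        mirror f (flight g (p i) (v i) (T i)) = 0 \<and>
        p (Suc i) = flight g (p i) (v i) (T i) \<and>
        v (Suc i) = reflect f (p (Suc i)) (flight_velocity g (v i) (T i)))"

lemma e_z_nth [simp]: "e_z $ 1 = 0" "e_z $ 2 = 0" "e_z $ 3 = 1"
  by (simp_all add: e_z_def)

lemma inner3: "(a::real^3) \<bullet> b = a$1*b$1 + a$2*b$2 + a$3*b$3"
  by (simp add: inner_vec_def sum_3)

lemma norm3: "(norm (a::real^3))\<^sup>2 = (a$1)\<^sup>2 + (a$2)\<^sup>2 + (a$3)\<^sup>2"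
  unfolding power2_norm_eq_inner inner3 by (simp add: power2_eq_square)

lemma vertex_eq:
  assumes "0 < g"
  shows "vertex g p v = flight g p v (v $ 3 / g)"
proof -
  have sq: "flight g p v t $ 3 = flight g p v (v $ 3 / g) $ 3 - g / 2 * (t - v $ 3 / g)\<^sup>2" for t
    using assms by (simp add: flight_def field_simps power2_eq_square)
  have le: "flight g p v t $ 3 \<le> flight g p v (v $ 3 / g) $ 3" for t
    using assms by (subst sq) simp
  show ?thesis unfolding vertex_def
  proof (rule the_equality)
    fix s assume s: "s \<in> range (flight g p v) \<and> (\<forall>q \<in> range (flight g p v). q $ 3 \<le> s $ 3)"
    then obtain t where t: "s = flight g p v t" by auto
    have "flight g p v (v $ 3 / g) $ 3 \<le> flight g p v t $ 3" using s t by auto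
    hence "g / 2 * (t - v $ 3 / g)\<^sup>2 \<le> 0" using sq[of t] by linarith
    hence "t = v $ 3 / g" using assms by (auto simp: mult_le_0_iff)
    thus "s = flight g p v (v $ 3 / g)" using t by simp
  qed (use le in auto)
qed

lemma flight_focus_eq:
  assumes "0 < g"
  shows "flight_focus g p v =
    vector [p $ 1, p $ 2, 2 * p $ 3 - energy_height g p v] + (v $ 3 / g) *\<^sub>R v"
  using assms
  unfolding energy_height_def norm3
  by (auto simp: vec_eq_iff forall_3 flight_focus_def vertex_eq flight_def
      focal_length_def field_simps power2_eq_square)

lemma energy_height_flight:
  assumes "0 < g"
  shows "energy_height g (flight g p v t) (flight_velocity g v t) = energy_height g p v"
  using assms unfolding energy_height_def norm3
  by (simp add: flight_def flight_velocity_def field_simps power2_eq_square)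

lemma angular_momentum_flight: "angular_momentum_z (flight g p v t) (flight_velocity g v t) = angular_momentum_z p v"
  by (simp add: angular_momentum_z_def flight_def flight_velocity_def algebra_simps)

lemma norm_reflect: "norm (reflect f p v) = norm v"
proof -
  let ?n = "mirror_grad f p"
  have nz: "?n \<bullet> ?n \<noteq> 0" 
  proof -
    have "?n $ 3 = 1" by (simp add: mirror_grad_def)
    hence "?n \<noteq> 0" by auto
    thus ?thesis by simp
  qed
  have "(reflect f p v) \<bullet> (reflect f p v) = v \<bullet> v"
    using nz unfolding reflect_def power2_norm_eq_inner
    by (simp add: inner_diff_left inner_diff_right inner_commute field_simps)
  thus ?thesis by (simp add: norm_eq_sqrt_inner)
qed

lemma angular_momentum_reflect: "angular_momentum_z p (reflect f p v) = angular_momentum_z p v"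
  by (simp add: angular_momentum_z_def reflect_def mirror_grad_def algebra_simps)

text \<open>
  The energy height and the reduced angular momentum keep their initial values along the whole
  trajectory, so the values at the start of flight 0 are the conserved ones.
\<close>

lemma trajectory_conserved:
  assumes "0 < g" and tr: "billiard_trajectory g f N p v T" and "enat i < N"
  shows "energy_height g (flight g (p i) (v i) t) (flight_velocity g (v i) t) = energy_height g (p 0) (v 0)"
    and "angular_momentum_z (flight g (p i) (v i) t) (flight_velocity g (v i) t) = angular_momentum_z (p 0) (v 0)"
proof -
  have "energy_height g (p i) (v i) = energy_height g (p 0) (v 0) \<and>
        angular_momentum_z (p i) (v i) = angular_momentum_z (p 0) (v 0)"
    using assms(3)
  proof (induction i)
    case (Suc i)
    have "enat i < N" using Suc.prems by (metis dual_order.strict_trans enat_ord_simps(2) lessI)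
    hence IH: "energy_height g (p i) (v i) = energy_height g (p 0) (v 0)"
        "angular_momentum_z (p i) (v i) = angular_momentum_z (p 0) (v 0)"
      using Suc.IH by auto
    have pS: "p (Suc i) = flight g (p i) (v i) (T i)"
      and vS: "v (Suc i) = reflect f (p (Suc i)) (flight_velocity g (v i) (T i))"
      using tr Suc.prems by (auto simp: billiard_trajectory_def)
    have "energy_height g (p (Suc i)) (v (Suc i)) =
        energy_height g (p (Suc i)) (flight_velocity g (v i) (T i))"
      by (simp add: vS energy_height_def norm_reflect)
    moreover have "angular_momentum_z (p (Suc i)) (v (Suc i)) =
        angular_momentum_z (p (Suc i)) (flight_velocity g (v i) (T i))"
      by (simp add: vS angular_momentum_reflect)
    ultimately show ?case
      using IH energy_height_flight[OF assms(1)] angular_momentum_flight pS by simp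
  qed simp
  thus "energy_height g (flight g (p i) (v i) t) (flight_velocity g (v i) t) = energy_height g (p 0) (v 0)"
    and "angular_momentum_z (flight g (p i) (v i) t) (flight_velocity g (v i) t) = angular_momentum_z (p 0) (v 0)"
    by (simp_all add: energy_height_flight[OF assms(1)] angular_momentum_flight)
qed

end

theory Submission
  imports Defs
begin

text \<open>
  At a point \<open>p\<close> with velocity \<open>v\<close>, the squared distance of the focus from the origin depends on
  \<open>v\<close> only through the energy height and the product \<open>v\<^sub>z (p \<bullet> v)\<close>. On the mirror
  \<open>p \<bullet> v = (z + 2 f) v'\<^sub>z\<close>, where \<open>v'\<close> is the reflected velocity, so that this product equals
  \<open>(z + 2 f) v\<^sub>z v'\<^sub>z\<close>, which is symmetric in \<open>v\<close> and \<open>v'\<close>. Reflecting twice gives \<open>v\<close> back, hence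
  the product is unchanged by the reflection.
\<close>

text \<open>The focus belongs to the whole parabola, so it may be computed at the point of
  impact.\<close>

lemma flight_focus_flight:
  assumes "0 < g"
  shows "flight_focus g (flight g p v t) (flight_velocity g v t) = flight_focus g p v"
  unfolding flight_focus_eq[OF assms] energy_height_flight[OF assms]
  using assms
  by (simp add: vec_eq_iff forall_3 flight_def flight_velocity_def field_simps power2_eq_square)

text \<open>Since \<open>(norm v)\<^sup>2 = 2 * g * (H - p $ 3)\<close> with \<open>H\<close> the
  energy height, the terms in \<open>(v $ 3)\<^sup>2 * (H - p $ 3)\<close> cancel.\<close>

lemma norm_flight_focus:
  assumes "0 < g"
  shows "(norm (flight_focus g p v))\<^sup>2 =
    (p $ 1)\<^sup>2 + (p $ 2)\<^sup>2 + (2 * p $ 3 - energy_height g p v)\<^sup>2 + 2 / g * (v $ 3 * (p \<bullet> v))"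
  unfolding flight_focus_eq[OF assms] norm3 inner3 energy_height_def
  using assms by (simp add: field_simps power2_eq_square)

lemma inner_mirror_grad_self_pos: "0 < mirror_grad f p \<bullet> mirror_grad f p"
  by (simp add: inner3 mirror_grad_def add_nonneg_pos)

lemma reflect_reflect: "reflect f p (reflect f p v) = v"
  using inner_mirror_grad_self_pos[of f p]
  by (simp add: reflect_def power2_norm_eq_inner inner_diff_left field_simps flip: scaleR_left_distrib)

text \<open>With \<open>n = mirror_grad f p\<close> and \<open>z = p $ 3\<close>,
  \<open>p = (z + 2 f) e_z - 2 f n\<close>. On the mirror
  \<open>z + 2 f = f (n \<bullet> n)\<close>, which cancels the denominator in
  \<open>reflect\<close>.\<close>

lemma inner_eq_reflect_nth_3:
  assumes "0 < f" and "mirror f p = 0"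
  shows "p \<bullet> v = (p $ 3 + 2 * f) * reflect f p v $ 3"
proof -
  let ?n = "mirror_grad f p"
  have on: "(p $ 1)\<^sup>2 + (p $ 2)\<^sup>2 = 4 * f * (p $ 3 + f)"
    using assms by (simp add: mirror_def field_simps)
  have "4 * f\<^sup>2 * (?n \<bullet> ?n) = (p $ 1)\<^sup>2 + (p $ 2)\<^sup>2 + 4 * f\<^sup>2"
    using assms by (simp add: inner3 mirror_grad_def field_simps power2_eq_square)
  also have "\<dots> = 4 * f * (p $ 3 + 2 * f)"
    unfolding on by (simp add: algebra_simps power2_eq_square)
  finally have nn: "p $ 3 + 2 * f = f * (?n \<bullet> ?n)"
    using assms by (simp add: power2_eq_square)
  have "(p $ 3 + 2 * f) * reflect f p v $ 3 = (p $ 3 + 2 * f) * v $ 3 - 2 * f * (v \<bullet> ?n)"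
    using inner_mirror_grad_self_pos[of f p]
    unfolding nn by (simp add: reflect_def power2_norm_eq_inner mirror_grad_def[of f p] field_simps)
  also have "\<dots> = p \<bullet> v"
    using assms by (simp add: inner3 mirror_grad_def field_simps)
  finally show ?thesis by simp
qed

lemma norm_flight_focus_reflect:
  assumes "0 < g" and "0 < f" and "mirror f p = 0"
  shows "norm (flight_focus g p (reflect f p v)) = norm (flight_focus g p v)"
proof -
  have "p \<bullet> reflect f p v = (p $ 3 + 2 * f) * v $ 3"
    using inner_eq_reflect_nth_3[OF assms(2,3)] by (simp add: reflect_reflect)
  hence "reflect f p v $ 3 * (p \<bullet> reflect f p v) = v $ 3 * (p \<bullet> v)"
    by (simp add: inner_eq_reflect_nth_3[OF assms(2,3), of v])
  moreover have "energy_height g p (reflect f p v) = energy_height g p v"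
    by (simp add: energy_height_def norm_reflect)
  ultimately have "(norm (flight_focus g p (reflect f p v)))\<^sup>2 = (norm (flight_focus g p v))\<^sup>2"
    by (simp add: norm_flight_focus[OF assms(1)])
  thus ?thesis by simp
qed

theorem theorem4p1:
  fixes g f_M H l_z :: real
    and N :: enat
    and p v :: "nat \<Rightarrow> real ^ 3"
    and T :: "nat \<Rightarrow> real"
  assumes "0 < g" and "0 < f_M"
    and "billiard_trajectory g f_M N p v T"
    and "H = energy_height g (p 0) (v 0)"
    and "l_z = angular_momentum_z (p 0) (v 0)"
  shows "\<exists>R \<ge> 0. \<forall>i. enat i < N \<longrightarrow> norm (flight_focus g (p i) (v i)) = R"
proof -
  have "norm (flight_focus g (p i) (v i)) = norm (flight_focus g (p 0) (v 0))" if "enat i < N" for i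
    using that
  proof (induction i)
    case (Suc i)
    have "enat i < N"
      using Suc.prems by (metis dual_order.strict_trans enat_ord_simps(2) lessI)
    moreover have "mirror f_M (p (Suc i)) = 0"
      and "p (Suc i) = flight g (p i) (v i) (T i)"
      and "v (Suc i) = reflect f_M (p (Suc i)) (flight_velocity g (v i) (T i))"
      using assms(3) Suc.prems by (auto simp: billiard_trajectory_def)
    \<comment> \<open>Move along flight \<open>i\<close> to the impact point, then reflect
      there.\<close>
    ultimately show ?case
      using Suc.IH norm_flight_focus_reflect[OF assms(1,2)] flight_focus_flight[OF assms(1)]
      by metis
  qed simp
  thus ?thesis by (meson norm_ge_zero)
qed

end
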